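(* Let $X$ be an implicative involutive BE algebra. The following are equivalent: (a) $X$ is an implicative-orthomodular lattice; (b) for all $x,y\in X$, whenever $x\mathcal{C}y$, then $y\mathcal{C}x$.
   Context: A BE algebra is an algebra $(X,\to,1)$ of type $(2,0)$ such that for all $x,y,z\in X$: $x\to x=1$; $x\to 1=1$; $1\to x=x$; $x\to(y\to z)=y\to(x\to z)$. Write $x\le y$ iff $x\to y=1$. It is bounded if there is $0\in X$ with $0\le x$ for all $x\in X$; then $x^*:=x\to 0$. A bounded BE algebra is involutive if $x^{**}=x$ for all $x$. A BE algebra is implicative if $(x\to y)\to x=x$ for all $x,y$. In an involutive BE algebra put $x\Cap y:=((x^*\to y^* )\to y^* )^*$. An implicative-orthomodular lattice is an implicative involutive BE algebra satisfying $x\Cap(y\to x)=x$ for all $x,y$. In an implicative involutive BE algebra, $x$ commutes with $y$, written $x\mathcal{C}y$, if $x=(x\to y^* )\to(x\to y)^*$. *)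

theory Defs
  imports Main
begin

unbundle no rtrancl_syntax

locale BE_algebra =
  fixes X :: "'a set"
    and imp :: "'a \<Rightarrow> 'a \<Rightarrow> 'a"  (infixr "\<rightarrow>" 65)
    and one :: 'a  ("\<one>")
  assumes imp_closed: "\<lbrakk>x \<in> X; y \<in> X\<rbrakk> \<Longrightarrow> x \<rightarrow> y \<in> X"
    and one_closed: "\<one> \<in> X"
    and imp_self: "x \<in> X \<Longrightarrow> x \<rightarrow> x = \<one>"
    and imp_one: "x \<in> X \<Longrightarrow> x \<rightarrow> \<one> = \<one>"
    and one_imp: "x \<in> X \<Longrightarrow> \<one> \<rightarrow> x = x"
    and imp_exchange: "\<lbrakk>x \<in> X; y \<in> X; z \<in> X\<rbrakk> \<Longrightarrow> x \<rightarrow> (y \<rightarrow> z) = y \<rightarrow> (x \<rightarrow> z)"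
begin

definition le :: "'a \<Rightarrow> 'a \<Rightarrow> bool"  (infix "\<preceq>" 50)
  where "x \<preceq> y \<longleftrightarrow> x \<rightarrow> y = \<one>"

end

text \<open>
  The relation \<open>\<preceq>\<close> of a general BE algebra need not be antisymmetric, so a least element
  need not be unique; it is therefore a parameter of the bounded structure.
\<close>

locale bounded_BE_algebra = BE_algebra X imp one
  for X :: "'a set"
    and imp :: "'a \<Rightarrow> 'a \<Rightarrow> 'a"  (infixr "\<rightarrow>" 65)
    and one :: 'a  ("\<one>") +
  fixes zero :: 'a  ("\<zero>")
  assumes zero_closed: "\<zero> \<in> X"
    and zero_le: "x \<in> X \<Longrightarrow> \<zero> \<preceq> x"
begin

definition star :: "'a \<Rightarrow> 'a"  ("_\<^sup>*" [1000] 999)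
  where "x\<^sup>* = x \<rightarrow> \<zero>"

end

locale involutive_BE_algebra = bounded_BE_algebra X imp one zero
  for X :: "'a set"
    and imp :: "'a \<Rightarrow> 'a \<Rightarrow> 'a"  (infixr "\<rightarrow>" 65)
    and one :: 'a  ("\<one>")
    and zero :: 'a  ("\<zero>") +
  assumes star_star: "x \<in> X \<Longrightarrow> (x\<^sup>*)\<^sup>* = x"
begin

text \<open>The operation \<open>\<sqinter>\<close> is not commutative in general, so it is not a lattice meet.\<close>

definition Cap :: "'a \<Rightarrow> 'a \<Rightarrow> 'a"  (infixl "\<sqinter>" 70)
  where "x \<sqinter> y = ((x\<^sup>* \<rightarrow> y\<^sup>*) \<rightarrow> y\<^sup>*)\<^sup>*"

end

locale implicative_BE_algebra = BE_algebra X imp one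
  for X :: "'a set"
    and imp :: "'a \<Rightarrow> 'a \<Rightarrow> 'a"  (infixr "\<rightarrow>" 65)
    and one :: 'a  ("\<one>") +
  assumes implicative: "\<lbrakk>x \<in> X; y \<in> X\<rbrakk> \<Longrightarrow> (x \<rightarrow> y) \<rightarrow> x = x"

locale implicative_involutive_BE_algebra =
  implicative_BE_algebra X imp one + involutive_BE_algebra X imp one zero
  for X :: "'a set"
    and imp :: "'a \<Rightarrow> 'a \<Rightarrow> 'a"  (infixr "\<rightarrow>" 65)
    and one :: 'a  ("\<one>")
    and zero :: 'a  ("\<zero>")
begin

definition commutes :: "'a \<Rightarrow> 'a \<Rightarrow> bool"  (infix "\<C>" 50)
  where "x \<C> y \<longleftrightarrow> x = (x \<rightarrow> y\<^sup>*) \<rightarrow> (x \<rightarrow> y)\<^sup>*"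

end

locale implicative_orthomodular_lattice = implicative_involutive_BE_algebra X imp one zero
  for X :: "'a set"
    and imp :: "'a \<Rightarrow> 'a \<Rightarrow> 'a"  (infixr "\<rightarrow>" 65)
    and one :: 'a  ("\<one>")
    and zero :: 'a  ("\<zero>") +
  assumes orthomodular: "\<lbrakk>x \<in> X; y \<in> X\<rbrakk> \<Longrightarrow> x \<sqinter> (y \<rightarrow> x) = x"

end

(* The operations join = (x imp zero) imp y and its De Morgan dual make an implicative involutive
   BE algebra an ortholattice, implicativity being absorption, and x commutes with y iff x is the
   join of the meets of x with y and with the complement of y. The claim is then the classical
   fact that an ortholattice is orthomodular iff commutation is symmetric. *)
theory Submission
  imports Defs
begin

context implicative_involutive_BE_algebra
begin

definition meet :: "'a \<Rightarrow> 'a \<Rightarrow> 'a"  (infixl "\<odot>" 70)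
  where "x \<odot> y = (x \<rightarrow> y\<^sup>*)\<^sup>*"

definition join :: "'a \<Rightarrow> 'a \<Rightarrow> 'a"  (infixl "\<oplus>" 68)
  where "x \<oplus> y = x\<^sup>* \<rightarrow> y"

lemma star_closed: "x \<in> X \<Longrightarrow> x\<^sup>* \<in> X"
  by (simp add: star_def imp_closed zero_closed)

lemma meet_closed: "\<lbrakk>x \<in> X; y \<in> X\<rbrakk> \<Longrightarrow> x \<odot> y \<in> X"
  by (simp add: meet_def imp_closed star_closed)

lemma join_closed: "\<lbrakk>x \<in> X; y \<in> X\<rbrakk> \<Longrightarrow> x \<oplus> y \<in> X"
  by (simp add: join_def imp_closed star_closed)

lemmas closed = imp_closed star_closed meet_closed join_closed

text \<open>Contraposition is the exchange law with \<open>\<zero>\<close> as the innermost term.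
  Commutativity of both lattice operations comes from it.\<close>

lemma imp_star_swap: "\<lbrakk>x \<in> X; y \<in> X\<rbrakk> \<Longrightarrow> x \<rightarrow> y\<^sup>* = y \<rightarrow> x\<^sup>*"
  using imp_exchange[of x y \<zero>] by (simp add: star_def zero_closed)

lemma meet_commute: "\<lbrakk>x \<in> X; y \<in> X\<rbrakk> \<Longrightarrow> x \<odot> y = y \<odot> x"
  by (simp add: meet_def imp_star_swap[of x y])

lemma join_commute: "\<lbrakk>x \<in> X; y \<in> X\<rbrakk> \<Longrightarrow> x \<oplus> y = y \<oplus> x"
  using imp_star_swap[of "x\<^sup>*" "y\<^sup>*"] by (simp add: join_def star_star closed)

lemma star_meet: "\<lbrakk>x \<in> X; y \<in> X\<rbrakk> \<Longrightarrow> (x \<odot> y)\<^sup>* = x\<^sup>* \<oplus> y\<^sup>*"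
  by (simp add: meet_def join_def star_star closed)

lemma star_join: "\<lbrakk>x \<in> X; y \<in> X\<rbrakk> \<Longrightarrow> (x \<oplus> y)\<^sup>* = x\<^sup>* \<odot> y\<^sup>*"
  by (simp add: meet_def join_def star_star closed)

text \<open>In terms of join, this is the exchange law for complemented arguments. Together with
  commutativity it amounts to associativity.\<close>

lemma join_left_commute:
  assumes "x \<in> X" "y \<in> X" "z \<in> X"
  shows "x \<oplus> (y \<oplus> z) = y \<oplus> (x \<oplus> z)"
  using assms imp_exchange[of "x\<^sup>*" "y\<^sup>*" z] by (simp add: join_def closed)

lemma meet_left_commute:
  assumes "x \<in> X" "y \<in> X" "z \<in> X"
  shows "x \<odot> (y \<odot> z) = y \<odot> (x \<odot> z)"
proof -
  have "(x\<^sup>* \<oplus> (y\<^sup>* \<oplus> z\<^sup>*))\<^sup>* = (y\<^sup>* \<oplus> (x\<^sup>* \<oplus> z\<^sup>*))\<^sup>*"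
    using assms join_left_commute[of "x\<^sup>*" "y\<^sup>*" "z\<^sup>*"] by (simp add: closed)
  then show ?thesis
    using assms by (simp add: star_join star_star closed)
qed

lemma join_meet_absorb:
  assumes "x \<in> X" "y \<in> X"
  shows "x \<oplus> (x \<odot> y) = x"
proof -
  \<comment> \<open>Contraposition brings the join to the left-hand side of the implicativity law at
    \<open>x\<close> and \<open>y\<^sup>*\<close>.\<close>
  have "x \<oplus> (x \<odot> y) = (x \<rightarrow> y\<^sup>*) \<rightarrow> x"
    using assms imp_star_swap[of "x\<^sup>*" "x \<rightarrow> y\<^sup>*"]
    by (simp add: join_def meet_def star_star closed)
  then show ?thesis
    using assms by (simp add: implicative closed)
qed

lemma meet_join_absorb:
  assumes "x \<in> X" "y \<in> X"
  shows "x \<odot> (x \<oplus> y) = x"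
proof -
  have "(x\<^sup>* \<oplus> x\<^sup>* \<odot> y\<^sup>*)\<^sup>* = (x\<^sup>*)\<^sup>*"
    using assms by (simp add: join_meet_absorb closed)
  then show ?thesis
    using assms by (simp add: star_join star_meet star_star closed)
qed

lemma commutes_iff: "\<lbrakk>x \<in> X; y \<in> X\<rbrakk> \<Longrightarrow> x \<C> y \<longleftrightarrow> x = x \<odot> y \<oplus> x \<odot> y\<^sup>*"
  by (simp add: commutes_def meet_def join_def star_star closed)

text \<open>So \<open>\<sqinter>\<close> is the Sasaki projection of \<open>x\<close> onto
  \<open>y\<close>. As \<open>y \<rightarrow> x\<close> is the join of \<open>x\<close> and
  \<open>y\<^sup>*\<close>, the orthomodularity axiom says that projecting \<open>x\<close> onto
  such an element above it fixes \<open>x\<close>.\<close>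

lemma Cap_eq: "x \<sqinter> y = (x \<oplus> y\<^sup>*) \<odot> y"
  by (simp add: Cap_def meet_def join_def)

lemma commutes_sym_if_orthomodular:
  assumes om: "\<And>x y. \<lbrakk>x \<in> X; y \<in> X\<rbrakk> \<Longrightarrow> x \<sqinter> (y \<rightarrow> x) = x"
    and x: "x \<in> X" and y: "y \<in> X" and xy: "x \<C> y"
  shows "y \<C> x"
proof -
  let ?p = "x \<odot> y"
  have p: "?p \<in> X" using x y by (simp add: closed)
  \<comment> \<open>Since \<open>?p\<^sup>*\<close> is an implication ending in
    \<open>y\<^sup>*\<close>, the axiom applies to the pair \<open>y\<^sup>*\<close>,
    \<open>?p\<^sup>*\<close>. Its complement splits \<open>y\<close> into \<open>?p\<close> and
    \<open>y \<odot> ?p\<^sup>*\<close>.\<close>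
  have "x \<rightarrow> y\<^sup>* = ?p\<^sup>*"
    using x y by (simp add: meet_def star_star closed)
  then have "(y\<^sup>* \<oplus> ?p) \<odot> ?p\<^sup>* = y\<^sup>*"
    using om[of "y\<^sup>*" x] x y p by (simp add: Cap_eq star_star closed)
  then have "((y\<^sup>* \<oplus> ?p) \<odot> ?p\<^sup>*)\<^sup>* = y"
    using y by (simp add: star_star)
  then have y_eq: "y \<odot> ?p\<^sup>* \<oplus> ?p = y"
    using y p by (simp add: star_meet[of _ "?p\<^sup>*"] star_join star_star closed)
  \<comment> \<open>It remains to identify the second part of \<open>y\<close> with
    \<open>y \<odot> x\<^sup>*\<close>. Complementing this decomposition of \<open>x\<close> and
    meeting with \<open>y\<close> does so, because \<open>y\<close> absorbs the factor
    \<open>y \<oplus> x\<^sup>*\<close>.\<close>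
  have "x = ?p \<oplus> x \<odot> y\<^sup>*"
    using x y xy by (simp add: commutes_iff)
  then have "x\<^sup>* = (?p \<oplus> x \<odot> y\<^sup>*)\<^sup>*" by simp
  also have "\<dots> = ?p\<^sup>* \<odot> (y \<oplus> x\<^sup>*)"
    using x y p
    by (simp add: star_join star_meet[of x "y\<^sup>*"] star_star closed join_commute[of y "x\<^sup>*"])
  finally have "y \<odot> x\<^sup>* = y \<odot> (?p\<^sup>* \<odot> (y \<oplus> x\<^sup>*))"
    by (rule arg_cong)
  also have "\<dots> = ?p\<^sup>* \<odot> (y \<odot> (y \<oplus> x\<^sup>*))"
    using x y p by (simp add: meet_left_commute[of y "?p\<^sup>*"] closed)
  also have "\<dots> = y \<odot> ?p\<^sup>*"
    using x y p by (simp add: meet_join_absorb closed meet_commute[of y "?p\<^sup>*"])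
  finally have "y = y \<odot> x \<oplus> y \<odot> x\<^sup>*"
    using x y p y_eq
    by (simp add: meet_commute[of y x] join_commute[of ?p "y \<odot> ?p\<^sup>*"] closed)
  then show ?thesis
    using x y by (simp add: commutes_iff)
qed

text \<open>In any ortholattice a smaller element commutes with a larger one, by absorption. Here
  \<open>?u\<^sup>*\<close> lies below \<open>x\<^sup>*\<close>, and the reversed commutation, once
  complemented, is the orthomodularity axiom.\<close>

lemma orthomodular_if_commutes_sym:
  assumes sym: "\<And>x y. \<lbrakk>x \<in> X; y \<in> X; x \<C> y\<rbrakk> \<Longrightarrow> y \<C> x"
    and x: "x \<in> X" and y: "y \<in> X"
  shows "x \<sqinter> (y \<rightarrow> x) = x"
proof -
  let ?u = "y \<rightarrow> x"
  have u: "?u \<in> X" using x y by (simp add: closed)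
  have "?u = x \<oplus> y\<^sup>*"
    using x y join_commute[of x "y\<^sup>*"] by (simp add: join_def star_star closed)
  then have "?u\<^sup>* = x\<^sup>* \<odot> y"
    using x y by (simp add: star_join star_star closed)
  \<comment> \<open>The order between \<open>?u\<^sup>*\<close> and \<open>x\<^sup>*\<close> is
    expressed first by a join and then, through the other absorption law, by a meet.\<close>
  then have "x\<^sup>* \<oplus> ?u\<^sup>* = x\<^sup>*"
    using x y by (simp add: join_meet_absorb closed)
  then have ux: "?u\<^sup>* \<odot> x\<^sup>* = ?u\<^sup>*"
    using x u meet_join_absorb[of "?u\<^sup>*" "x\<^sup>*"]
    by (simp add: join_commute[of "?u\<^sup>*" "x\<^sup>*"] closed)
  then have "?u\<^sup>* \<C> x\<^sup>*"
    using x u by (simp add: commutes_iff star_star closed join_meet_absorb)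
  then have "x\<^sup>* \<C> ?u\<^sup>*"
    using x u sym[of "?u\<^sup>*" "x\<^sup>*"] by (simp add: closed)
  then have "x\<^sup>* = ?u\<^sup>* \<oplus> x\<^sup>* \<odot> ?u"
    using x u ux meet_commute[of "x\<^sup>*" "?u\<^sup>*"]
    by (simp add: commutes_iff star_star closed)
  also have "\<dots> = x\<^sup>* \<odot> ?u \<oplus> ?u\<^sup>*"
    using x u by (simp add: join_commute[of "?u\<^sup>*"] closed)
  finally have "(x\<^sup>*)\<^sup>* = (x\<^sup>* \<odot> ?u \<oplus> ?u\<^sup>*)\<^sup>*" by simp
  then have "x = (x \<oplus> ?u\<^sup>*) \<odot> ?u"
    using x u by (simp add: star_join star_meet star_star closed)
  then show ?thesis
    by (simp add: Cap_eq)
qed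

end

theorem theorem4p7:
  fixes X :: "'a set"
    and imp :: "'a \<Rightarrow> 'a \<Rightarrow> 'a"
    and one zero :: 'a
  assumes "implicative_involutive_BE_algebra X imp one zero"
  shows "implicative_orthomodular_lattice X imp one zero \<longleftrightarrow>
    (\<forall>x\<in>X. \<forall>y\<in>X.
      implicative_involutive_BE_algebra.commutes imp zero x y \<longrightarrow>
      implicative_involutive_BE_algebra.commutes imp zero y x)"
proof -
  interpret implicative_involutive_BE_algebra X imp one zero by fact
  show ?thesis
  proof
    assume "implicative_orthomodular_lattice X imp one zero"
    then interpret implicative_orthomodular_lattice X imp one zero .
    show "\<forall>x\<in>X. \<forall>y\<in>X. commutes x y \<longrightarrow> commutes y x"
      using commutes_sym_if_orthomodular[OF orthomodular] by blast
  next
    assume "\<forall>x\<in>X. \<forall>y\<in>X. commutes x y \<longrightarrow> commutes y x"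
    then show "implicative_orthomodular_lattice X imp one zero"
      by unfold_locales (blast intro: orthomodular_if_commutes_sym)
  qed
qed

end
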